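(* Let $A$ be a finite set, let $X \subset A^{\mathbb{Z}}$ be a subshift of finite type, and let $\mathcal{C}$ denote the poset of irreducible components of $X$. Suppose that $\tau \colon X \to X$ is a surjective endomorphism of $X$ and let $\rho = \rho_\tau \colon \mathcal{C} \to \mathcal{C}$ denote the poset endomorphism of $\mathcal{C}$ associated with $\tau$. Then the following hold: (i) the map $\rho \colon \mathcal{C} \to \mathcal{C}$ is a poset automorphism of $\mathcal{C}$; (ii) one has $\tau^{-1}(C) = \rho^{-1}(C)$ for each $C \in \mathcal{C}$ (where $\tau^{-1}(C)\subset X$ is the preimage of the set $C$ and $\rho^{-1}(C)\in\mathcal{C}$ is the image of the element $C$ under the inverse bijection of $\rho$); (iii) one has $\tau(C) = \rho(C)$ for each $C \in \mathcal{C}$; (iv) one has $\tau(\mathrm{NW}(X)) = \mathrm{NW}(X)$ and $\tau^{-1}(\mathrm{NW}(X)) = \mathrm{NW}(X)$; (v) one has $\tau(X \setminus \mathrm{NW}(X)) = X \setminus \mathrm{NW}(X)$ and $\tau^{-1}(X \setminus \mathrm{NW}(X)) = X \setminus \mathrm{NW}(X)$.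
   Context: $A^{\mathbb{Z}}$ carries the product topology ($A$ discrete) and the shift homeomorphism $\sigma$, $(\sigma(x))_i = x_{i+1}$. A subshift is a closed subset $X\subset A^{\mathbb{Z}}$ with $\sigma(X)=X$. It is of finite type if there are an integer $n\ge 0$ and $S\subset A^n$ such that $X$ is the set of all $x\in A^{\mathbb{Z}}$ with $(x_{i+1},\dots,x_{i+n})\in S$ for all $i\in\mathbb{Z}$. An endomorphism of $X$ is a continuous map $\tau\colon X\to X$ commuting with $\sigma$. $\mathrm{NW}(X)$ is the set of $x\in X$ such that for every neighborhood $U$ of $x$ in $X$ there is $n\ge1$ with $U\cap\sigma^n(U)\neq\varnothing$. A subshift $Y$ is irreducible if it is non-empty and for all non-empty open $U,W\subset Y$ there is $n\ge 1$ with $U\cap\sigma^n(W)\ne\varnothing$. For a subshift of finite type $X$, there is a unique finite partition $\mathcal{C}$ of $\mathrm{NW}(X)$ into irreducible subshifts; its elements are the irreducible components of $X$. For $x\in X$, $\alpha(x)$ (resp. $\omega(x)$) is the set of limits of convergent sequences $(\sigma^{-n_k}(x))_k$ (resp. $(\sigma^{n_k}(x))_k$) with $(n_k)$ a strictly increasing sequence of non-negative integers; there are unique $C_\alpha(x),C_\omega(x)\in\mathcal{C}$ with $\alpha(x)\subset C_\alpha(x)$, $\omega(x)\subset C_\omega(x)$. $\mathcal{C}$ is partially ordered by: $C\preceq C'$ iff there is $x\in X$ with $C_\alpha(x)=C$ and $C_\omega(x)=C'$. For an endomorphism $\tau$ of $X$, $\rho_\tau\colon\mathcal{C}\to\mathcal{C}$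 is the unique map with $\tau(C)\subset\rho_\tau(C)$ for all $C\in\mathcal{C}$; it is order-preserving. *)

theory Defs
  imports "HOL-Analysis.Analysis" "HOL-Library.Disjoint_Sets"
begin

definition full_shift :: "'a set \<Rightarrow> (int \<Rightarrow> 'a) topology" where
  "full_shift A = product_topology (\<lambda>_. discrete_topology A) UNIV"

definition shift_map :: "(int \<Rightarrow> 'a) \<Rightarrow> (int \<Rightarrow> 'a)" where
  "shift_map x = (\<lambda>i. x (i + 1))"

abbreviation shift_top :: "'a set \<Rightarrow> (int \<Rightarrow> 'a) set \<Rightarrow> (int \<Rightarrow> 'a) topology" where
  "shift_top A X \<equiv> subtopology (full_shift A) X"

definition subshift :: "'a set \<Rightarrow> (int \<Rightarrow> 'a) set \<Rightarrow> bool" where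
  "subshift A X \<longleftrightarrow> closedin (full_shift A) X \<and> shift_map ` X = X"

text \<open>Elements of $A^n$ are lists of length $n$ over $A$; the word of $x$ read at position $i$
  is $(x_{i+1},\dots,x_{i+n})$.\<close>

definition subshift_finite_type :: "'a set \<Rightarrow> (int \<Rightarrow> 'a) set \<Rightarrow> bool" where
  "subshift_finite_type A X \<longleftrightarrow> subshift A X \<and>
     (\<exists>n::nat. \<exists>S \<subseteq> {w. set w \<subseteq> A \<and> length w = n}.
        X = {x \<in> topspace (full_shift A). \<forall>i. map (\<lambda>j. x (i + int j)) [1..<n + 1] \<in> S})"

definition shift_endomorphism ::
    "'a set \<Rightarrow> (int \<Rightarrow> 'a) set \<Rightarrow> ((int \<Rightarrow> 'a) \<Rightarrow> (int \<Rightarrow> 'a)) \<Rightarrow> bool" where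
  "shift_endomorphism A X \<tau> \<longleftrightarrow> continuous_map (shift_top A X) (shift_top A X) \<tau> \<and>
     (\<forall>x\<in>X. \<tau> (shift_map x) = shift_map (\<tau> x))"

definition neighborhood_in :: "'b topology \<Rightarrow> 'b \<Rightarrow> 'b set \<Rightarrow> bool" where
  "neighborhood_in T x U \<longleftrightarrow> U \<subseteq> topspace T \<and> (\<exists>V. openin T V \<and> x \<in> V \<and> V \<subseteq> U)"

definition NW :: "'a set \<Rightarrow> (int \<Rightarrow> 'a) set \<Rightarrow> (int \<Rightarrow> 'a) set" where
  "NW A X = {x \<in> X. \<forall>U. neighborhood_in (shift_top A X) x U \<longrightarrow>
     (\<exists>n::nat. n \<ge> 1 \<and> U \<inter> (shift_map ^^ n) ` U \<noteq> {})}"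

definition irreducible_subshift :: "'a set \<Rightarrow> (int \<Rightarrow> 'a) set \<Rightarrow> bool" where
  "irreducible_subshift A Y \<longleftrightarrow> subshift A Y \<and> Y \<noteq> {} \<and>
     (\<forall>U W. openin (shift_top A Y) U \<and> U \<noteq> {} \<and> openin (shift_top A Y) W \<and> W \<noteq> {} \<longrightarrow>
        (\<exists>n::nat. n \<ge> 1 \<and> U \<inter> (shift_map ^^ n) ` W \<noteq> {}))"

definition irr_components :: "'a set \<Rightarrow> (int \<Rightarrow> 'a) set \<Rightarrow> (int \<Rightarrow> 'a) set set" where
  "irr_components A X = (THE \<C>. finite \<C> \<and> partition_on (NW A X) \<C> \<and>
     (\<forall>C\<in>\<C>. irreducible_subshift A C))"

definition alpha_limit_set :: "'a set \<Rightarrow> (int \<Rightarrow> 'a) set \<Rightarrow> (int \<Rightarrow> 'a) \<Rightarrow> (int \<Rightarrow> 'a) set" where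
  "alpha_limit_set A X x = {y. \<exists>n::nat \<Rightarrow> nat. strict_mono n \<and>
     limitin (shift_top A X) (\<lambda>k. (inv shift_map ^^ n k) x) y sequentially}"

definition omega_limit_set :: "'a set \<Rightarrow> (int \<Rightarrow> 'a) set \<Rightarrow> (int \<Rightarrow> 'a) \<Rightarrow> (int \<Rightarrow> 'a) set" where
  "omega_limit_set A X x = {y. \<exists>n::nat \<Rightarrow> nat. strict_mono n \<and>
     limitin (shift_top A X) (\<lambda>k. (shift_map ^^ n k) x) y sequentially}"

definition C_alpha :: "'a set \<Rightarrow> (int \<Rightarrow> 'a) set \<Rightarrow> (int \<Rightarrow> 'a) \<Rightarrow> (int \<Rightarrow> 'a) set" where
  "C_alpha A X x = (THE C. C \<in> irr_components A X \<and> alpha_limit_set A X x \<subseteq> C)"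

definition C_omega :: "'a set \<Rightarrow> (int \<Rightarrow> 'a) set \<Rightarrow> (int \<Rightarrow> 'a) \<Rightarrow> (int \<Rightarrow> 'a) set" where
  "C_omega A X x = (THE C. C \<in> irr_components A X \<and> omega_limit_set A X x \<subseteq> C)"

definition component_le ::
    "'a set \<Rightarrow> (int \<Rightarrow> 'a) set \<Rightarrow> (int \<Rightarrow> 'a) set \<Rightarrow> (int \<Rightarrow> 'a) set \<Rightarrow> bool" where
  "component_le A X C C' \<longleftrightarrow> (\<exists>x\<in>X. C_alpha A X x = C \<and> C_omega A X x = C')"

text \<open>Maps from the set of components to itself are normalised to be \<^const>\<open>undefined\<close> elsewhere
  (\<open>\<rightarrow>\<^sub>E\<close>), so that the map is unique as a HOL function.\<close>

definition component_map :: "'a set \<Rightarrow> (int \<Rightarrow> 'a) set \<Rightarrow> ((int \<Rightarrow> 'a) \<Rightarrow> (int \<Rightarrow> 'a)) \<Rightarrow>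
    (int \<Rightarrow> 'a) set \<Rightarrow> (int \<Rightarrow> 'a) set" where
  "component_map A X \<tau> = (THE \<rho>. \<rho> \<in> irr_components A X \<rightarrow>\<^sub>E irr_components A X \<and>
     (\<forall>C \<in> irr_components A X. \<tau> ` C \<subseteq> \<rho> C))"

definition poset_automorphism_on :: "'b set \<Rightarrow> ('b \<Rightarrow> 'b \<Rightarrow> bool) \<Rightarrow> ('b \<Rightarrow> 'b) \<Rightarrow> bool" where
  "poset_automorphism_on P le f \<longleftrightarrow> bij_betw f P P \<and>
     monotone_on P le le f \<and> monotone_on P le le (inv_into P f)"

end

theory Submission imports Defs begin

text \<open>
  As \<open>X\<close> is described by words of a fixed length \<open>n\<close>, two points of \<open>X\<close> sharing such a word can
  be glued there. So for the preorder "\<open>u\<close> occurs weakly before \<open>v\<close> in some point of \<open>X\<close>" on words,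
  the irreducible components are the sets of points all of whose words lie in one given strongly
  connected class. A point whose \<open>\<alpha>\<close>- and \<open>\<omega>\<close>-limit sets lie in the same component \<open>D\<close> then lies
  in \<open>D\<close> itself, as each of its words sits between two words of \<open>D\<close>.

  By continuity \<open>C\<^sub>\<omega>(\<tau> x) = \<rho> (C\<^sub>\<omega> x)\<close>, and likewise for \<open>\<alpha>\<close>. Lifting points along the surjection
  \<open>\<tau>\<close> shows that \<open>\<rho>\<close> is onto the finite set of components, hence bijective, and that \<open>\<rho>\<^sup>-\<^sup>1\<close>
  preserves the order. If \<open>\<tau> x \<in> C\<close> then both limit components of \<open>x\<close> are \<open>\<rho>\<^sup>-\<^sup>1 C\<close>, so
  \<open>x \<in> \<rho>\<^sup>-\<^sup>1 C\<close>; the remaining claims follow from this.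
\<close>

section \<open>Shifts and cylinders\<close>

definition shift_by :: "int \<Rightarrow> (int \<Rightarrow> 'a) \<Rightarrow> (int \<Rightarrow> 'a)" where
  "shift_by s x = (\<lambda>k. x (k + s))"

lemma shift_by_shift_by [simp]: "shift_by s (shift_by t x) = shift_by (s + t) x"
  by (simp add: shift_by_def fun_eq_iff algebra_simps)

lemma shift_by_0 [simp]: "shift_by 0 x = x"
  by (simp add: shift_by_def)

lemma shift_map_eq: "shift_map = shift_by 1"
  by (simp add: shift_map_def shift_by_def fun_eq_iff)

lemma funpow_shift_by: "(shift_by s ^^ n) x = shift_by (int n * s) x"
  by (induction n) (simp_all add: algebra_simps)

lemma funpow_shift_map: "shift_map ^^ n = shift_by (int n)"
  by (rule ext) (simp add: shift_map_eq funpow_shift_by)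

lemma funpow_inv_shift_map: "inv shift_map ^^ n = (shift_by (- int n) :: (int \<Rightarrow> 'a) \<Rightarrow> _)"
proof -
  have "inv shift_map = (shift_by (-1) :: (int \<Rightarrow> 'a) \<Rightarrow> _)"
    by (rule inv_equality) (simp_all add: shift_map_eq)
  then show ?thesis by (rule_tac ext) (simp add: funpow_shift_by)
qed

lemma topspace_full_shift: "topspace (full_shift A) = {x. range x \<subseteq> A}"
  by (auto simp: full_shift_def PiE_UNIV_domain Pi_def)

lemma subshift_subset: "subshift A X \<Longrightarrow> X \<subseteq> topspace (full_shift A)"
  by (auto simp: subshift_def dest: closedin_subset)

lemma shift_by_mem_subshift:
  assumes "subshift A X" "x \<in> X"
  shows "shift_by s x \<in> X"
proof -
  have sur: "shift_map ` X = X" using assms by (simp add: subshift_def)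
  have pos: "shift_by (int n) y \<in> X" if "y \<in> X" for n y
  proof (induction n)
    case (Suc n)
    then have "shift_map (shift_by (int n) y) \<in> X" using sur by blast
    then show ?case by (simp add: shift_map_eq)
  qed (use that in simp)
  have neg: "shift_by (- int n) y \<in> X" if "y \<in> X" for n y
  proof (induction n)
    case (Suc n)
    \<comment> \<open>Surjectivity of the shift on \<open>X\<close> supplies \<open>z\<close>;
      injectivity identifies it with the backward shift.\<close>
    then obtain z where "z \<in> X" "shift_by (- int n) y = shift_map z" using sur by blast
    then have "shift_by (-1) (shift_by (- int n) y) \<in> X" by (simp add: shift_map_eq)
    then show ?case by simp
  qed (use that in simp)
  show ?thesis
    using pos[OF assms(2), of "nat s"] neg[OF assms(2), of "nat (- s)"] by (cases "s \<ge> 0") auto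
qed

lemma shift_by_mem_subshift_iff:
  "subshift A X \<Longrightarrow> shift_by s x \<in> X \<longleftrightarrow> x \<in> X"
  using shift_by_mem_subshift[of A X x s] shift_by_mem_subshift[of A X "shift_by s x" "- s"] by auto

lemma openin_cylinder:
  assumes "finite F" "range x \<subseteq> A"
  shows "openin (full_shift A) {y \<in> topspace (full_shift A). \<forall>k\<in>F. y k = x k}"
proof -
  have "{y \<in> topspace (full_shift A). \<forall>k\<in>F. y k = x k}
      = (\<Pi>\<^sub>E k\<in>UNIV. if k \<in> F then {x k} else A)"
    using assms(2) by (auto simp: topspace_full_shift PiE_UNIV_domain Pi_def split: if_splits)
  moreover have "openin (full_shift A) (\<Pi>\<^sub>E k\<in>UNIV. if k \<in> F then {x k} else A)"
    unfolding full_shift_def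
  proof (rule product_topology_basis)
    show "openin (discrete_topology A) (if k \<in> F then {x k} else A)" for k
      using assms(2) by auto
    show "finite {k. (if k \<in> F then {x k} else A) \<noteq> topspace (discrete_topology A)}"
      by (rule finite_subset[OF _ assms(1)]) auto
  qed
  ultimately show ?thesis by simp
qed

lemma openin_cylinder_subspace:
  assumes "finite F" "x \<in> X" "X \<subseteq> topspace (full_shift A)"
  shows "openin (shift_top A X) {y \<in> X. \<forall>k\<in>F. y k = x k}"
proof -
  have "range x \<subseteq> A" using assms by (auto simp: topspace_full_shift)
  moreover have "{y \<in> X. \<forall>k\<in>F. y k = x k}
      = X \<inter> {y \<in> topspace (full_shift A). \<forall>k\<in>F. y k = x k}" using assms by auto
  ultimately show ?thesis
    by (simp add: openin_cylinder[OF assms(1)] openin_subtopology_Int2)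
qed

text \<open>A basic open set of the product restricts only finitely many coordinates, so one
  symmetric window contains them all.\<close>

lemma openin_contains_cylinder:
  assumes "openin (shift_top A X) U" "x \<in> U"
  obtains m :: int where "m \<ge> 0" "\<And>y. y \<in> X \<Longrightarrow> y \<in> topspace (full_shift A) \<Longrightarrow>
     (\<And>k. - m \<le> k \<Longrightarrow> k \<le> m \<Longrightarrow> y k = x k) \<Longrightarrow> y \<in> U"
proof -
  obtain T where T: "openin (full_shift A) T" "U = T \<inter> X"
    using assms by (auto simp: openin_subtopology)
  then have "x \<in> T" using assms by auto
  then obtain V where fin: "finite {i. V i \<noteq> topspace (discrete_topology A)}"
    and V: "x \<in> Pi\<^sub>E UNIV V" "Pi\<^sub>E UNIV V \<subseteq> T"
    using T(1) unfolding full_shift_def openin_product_topology_alt by force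
  obtain m where m: "\<forall>i\<in>{i. V i \<noteq> topspace (discrete_topology A)}. \<bar>i\<bar> \<le> m"
    using finite_imageI[OF fin, of abs] bdd_above.I2 bdd_above_finite
    by (metis (no_types, lifting) bdd_above.E imageI)
  show thesis
  \<comment> \<open>If no coordinate is restricted, the bound \<open>m\<close> is arbitrary and may
    be negative.\<close>
  proof (rule that[of "max m 0"])
    fix y assume y: "y \<in> X" "y \<in> topspace (full_shift A)"
      and eq: "\<And>k. - max m 0 \<le> k \<Longrightarrow> k \<le> max m 0 \<Longrightarrow> y k = x k"
    have "y i \<in> V i" for i
    proof (cases "V i = A")
      case True
      then show ?thesis using y(2) by (auto simp: topspace_full_shift)
    next
      case False
      then have "\<bar>i\<bar> \<le> m" using m by auto
      then have "y i = x i" by (intro eq) auto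
      then show ?thesis using V(1) by (auto simp: PiE_UNIV_domain)
    qed
    then have "y \<in> T" using V(2) by (auto simp: PiE_UNIV_domain)
    then show "y \<in> U" using T(2) y by auto
  qed simp
qed

text \<open>A countable product of finite discrete spaces is compact and metrizable, and in metric
  spaces compactness yields convergent subsequences.\<close>

lemma sequentially_compact_full_shift:
  assumes "finite A" "closedin (full_shift A) X" "range f \<subseteq> X"
  obtains l r where "l \<in> X" "strict_mono (r :: nat \<Rightarrow> nat)"
    "limitin (shift_top A X) (f \<circ> r) l sequentially"
proof -
  have "compact_space (full_shift A)"
    using assms(1) by (simp add: full_shift_def compact_space_product_topology
        compact_space_discrete_topology)
  then have comp: "compactin (full_shift A) X"
    using assms(2) closedin_compact_space by blast
  have "metrizable_space (full_shift A)"
    by (simp add: full_shift_def metrizable_space_product_topology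
        metrizable_space_discrete_topology)
  then obtain M d where M: "Metric_space M d" "full_shift A = Metric_space.mtopology M d"
    by (auto simp: metrizable_space_def)
  then obtain l r where l: "l \<in> X" "strict_mono (r :: nat \<Rightarrow> nat)"
    "limitin (full_shift A) (f \<circ> r) l sequentially"
    using comp assms(3) unfolding M(2) Metric_space.compactin_sequentially[OF M(1)] by metis
  then have "limitin (shift_top A X) (f \<circ> r) l sequentially"
    using assms(3) by (auto simp: limitin_subtopology image_subset_iff intro!: always_eventually)
  with l that show thesis by blast
qed

section \<open>Irreducible subshifts\<close>

text \<open>The points sent into one part and those sent outside it form two open shift-invariant
  sets, which irreducibility does not allow to be both non-empty. The identity as \<open>f\<close>
  serves the uniqueness of the components, \<tau> as \<open>f\<close> the existence of
  \<rho>.\<close>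

lemma irreducible_image_in_one_part:
  assumes irr: "irreducible_subshift A Y"
    and cont: "continuous_map (shift_top A Y) (full_shift A) f"
    and equi: "\<And>y. y \<in> Y \<Longrightarrow> f (shift_map y) = shift_map (f y)"
    and fin: "finite \<C>" and sub: "\<And>C. C \<in> \<C> \<Longrightarrow> subshift A C" and disj: "disjoint \<C>"
    and cover: "f ` Y \<subseteq> \<Union>\<C>"
  shows "\<exists>C\<in>\<C>. f ` Y \<subseteq> C"
proof -
  have Y: "subshift A Y" "Y \<noteq> {}" using irr by (auto simp: irreducible_subshift_def)
  then have top: "topspace (shift_top A Y) = Y" using subshift_subset by fastforce
  obtain y where y: "y \<in> Y" using Y by auto
  then obtain C where C: "C \<in> \<C>" "f y \<in> C" using cover by auto
  \<comment> \<open>Avoiding the finitely many other closed parts is an open condition; by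
    disjointness it amounts to landing in \<open>C\<close>.\<close>
  define U where "U = {z \<in> Y. f z \<notin> \<Union>(\<C> - {C})}"
  define W where "W = {z \<in> Y. f z \<notin> C}"
  have Ueq: "U = {z \<in> Y. f z \<in> C}"
    using cover C(1) disj by (auto simp: U_def disjoint_def)
  have open_pre: "openin (shift_top A Y) {z \<in> Y. f z \<notin> K}" if "closedin (full_shift A) K" for K
  proof -
    have "openin (full_shift A) (topspace (full_shift A) - K)" using that by blast
    then have "openin (shift_top A Y) {z \<in> topspace (shift_top A Y).
        f z \<in> topspace (full_shift A) - K}"
      using cont openin_continuous_map_preimage by blast
    moreover have "f z \<in> topspace (full_shift A)" if "z \<in> Y" for z
      using continuous_map_image_subset_topspace[OF cont] that top by auto
    ultimately show ?thesis using top by (smt (verit) Collect_cong Diff_iff)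
  qed
  have "openin (shift_top A Y) U" unfolding U_def
    using fin sub by (intro open_pre closedin_Union) (auto simp: subshift_def)
  moreover have "openin (shift_top A Y) W" unfolding W_def
    using C(1) sub by (intro open_pre) (auto simp: subshift_def)
  moreover have "U \<noteq> {}" using y C Ueq by auto
  moreover have "U \<inter> (shift_map ^^ n) ` W = {}" for n
  proof -
    have pow: "f ((shift_map ^^ n) w) = (shift_map ^^ n) (f w)" if "w \<in> Y" for w
    proof (induction n)
      case (Suc n)
      have "(shift_map ^^ n) w \<in> Y"
        using Y(1) that by (simp add: funpow_shift_map shift_by_mem_subshift)
      with Suc show ?case by (simp add: equi)
    qed simp
    have "w \<notin> W" if "(shift_map ^^ n) w \<in> U" for w
    proof
      assume w: "w \<in> W"
      then have "f ((shift_map ^^ n) w) = shift_by (int n) (f w)"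
        using pow by (simp add: W_def funpow_shift_map)
      then have "f w \<in> C"
        using that Ueq shift_by_mem_subshift_iff[OF sub[OF C(1)]] by auto
      then show False using w by (simp add: W_def)
    qed
    then show ?thesis by blast
  qed
  ultimately have "W = {}" using irr unfolding irreducible_subshift_def by meson
  then show ?thesis using C(1) by (auto simp: W_def)
qed

lemma irreducible_in_one_part:
  assumes "irreducible_subshift A Y" "finite \<C>" "\<And>C. C \<in> \<C> \<Longrightarrow> subshift A C" "disjoint \<C>"
    and "Y \<subseteq> \<Union>\<C>"
  shows "\<exists>C\<in>\<C>. Y \<subseteq> C"
  using irreducible_image_in_one_part[of A Y "\<lambda>x. x" \<C>] assms
  by (simp add: continuous_map_from_subtopology)

text \<open>A block \<open>C\<close> lies in some \<open>D\<close>, which lies in some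
  \<open>C'\<close>; disjointness forces \<open>C = C'\<close>, so \<open>C = D\<close>. Swapping
  the two partitions gives equality.\<close>

lemma irreducible_partition_unique:
  assumes "finite \<C>" "partition_on N \<C>" "\<And>C. C \<in> \<C> \<Longrightarrow> irreducible_subshift A C"
    and "finite \<D>" "partition_on N \<D>" "\<And>D. D \<in> \<D> \<Longrightarrow> irreducible_subshift A D"
  shows "\<C> \<subseteq> \<D>"
proof
  fix C assume C: "C \<in> \<C>"
  have sub: "\<And>C. C \<in> \<C> \<Longrightarrow> subshift A C" "\<And>C. C \<in> \<D> \<Longrightarrow> subshift A C"
    using assms by (auto simp: irreducible_subshift_def)
  obtain D where D: "D \<in> \<D>" "C \<subseteq> D"
    using irreducible_in_one_part[of A C \<D>] C assms sub
    by (metis Union_upper partition_onD1 partition_onD2)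
  obtain C' where C': "C' \<in> \<C>" "D \<subseteq> C'"
    using irreducible_in_one_part[of A D \<C>] D assms sub
    by (metis Union_upper partition_onD1 partition_onD2)
  have "C \<noteq> {}" using C assms partition_onD3 by metis
  then have "C = C'"
    using C C' D assms(2) partition_onD2 by (metis disjointD inf.absorb1 order_trans)
  then show "C \<in> \<D>" using D C' by auto
qed

section \<open>Words and reachability in a subshift of finite type\<close>

definition word :: "nat \<Rightarrow> int \<Rightarrow> (int \<Rightarrow> 'a) \<Rightarrow> 'a list" where
  "word n i x = map (\<lambda>j. x (i + int j)) [1..<n + 1]"

lemma word_eq_iff:
  "word n i x = word n j y \<longleftrightarrow> (\<forall>k. 1 \<le> k \<and> k \<le> int n \<longrightarrow> x (i + k) = y (j + k))"
proof -
  have "word n i x = word n j y \<longleftrightarrow> (\<forall>k\<in>{1..<n+1}. x (i + int k) = y (j + int k))"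
    unfolding word_def map_eq_conv set_upt by (rule refl)
  also have "\<dots> \<longleftrightarrow> (\<forall>k. 1 \<le> k \<and> k \<le> int n \<longrightarrow> x (i + k) = y (j + k))"
  proof (intro iffI allI impI)
    fix k assume *: "\<forall>k\<in>{1..<n+1}. x (i + int k) = y (j + int k)" "1 \<le> k \<and> k \<le> int n"
    then have "nat k \<in> {1..<n+1}" by auto
    with *(1) have "x (i + int (nat k)) = y (j + int (nat k))" by blast
    with *(2) show "x (i + k) = y (j + k)" by simp
  qed auto
  finally show ?thesis .
qed

lemma word_shift_by: "word n i (shift_by s x) = word n (i + s) x"
  by (simp add: word_eq_iff) (simp add: shift_by_def algebra_simps)

locale sft =
  fixes A :: "'a set" and X :: "(int \<Rightarrow> 'a) set" and n :: nat and S :: "'a list set"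
  assumes finite_alphabet: "finite A"
    and subshift: "subshift A X"
    and X_eq: "X = {x \<in> topspace (full_shift A). \<forall>i. word n i x \<in> S}"
begin

lemma X_subset: "X \<subseteq> topspace (full_shift A)"
  by (rule subshift_subset[OF subshift])

lemma topspace_X: "topspace (shift_top A X) = X"
  using X_subset by auto

lemma shift_by_mem: "x \<in> X \<Longrightarrow> shift_by s x \<in> X"
  by (rule shift_by_mem_subshift[OF subshift])

definition reach :: "'a list \<Rightarrow> 'a list \<Rightarrow> bool" where
  "reach u v \<longleftrightarrow> (\<exists>x\<in>X. \<exists>i j. i \<le> j \<and> word n i x = u \<and> word n j x = v)"

lemma reach_word: "x \<in> X \<Longrightarrow> i \<le> j \<Longrightarrow> reach (word n i x) (word n j x)"
  by (auto simp: reach_def)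

text \<open>The two points agree on the whole overlap of length \<open>n\<close>, so every window of
  length \<open>n\<close> in \<open>g\<close> is a window of \<open>x\<close> or of
  \<open>y\<close>. This is where finite type enters.\<close>

lemma glue:
  assumes x: "x \<in> X" and y: "y \<in> X" and eq: "word n i x = word n j y"
  defines "g \<equiv> \<lambda>k. if k \<le> i then x k else y (k - i + j)"
  shows "g \<in> X" "\<And>k. k \<le> i \<Longrightarrow> word n k g = word n k x"
    "\<And>k. k \<ge> i \<Longrightarrow> word n k g = word n (k - i + j) y"
proof -
  have y': "y (k + j - i) = x k" if "i < k" "k \<le> i + int n" for k
    using eq[unfolded word_eq_iff, rule_format, of "k - i"] that by (simp add: algebra_simps)
  show le: "word n k g = word n k x" if "k \<le> i" for k
    unfolding word_eq_iff
  proof (intro allI impI)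
    fix l assume "1 \<le> l \<and> l \<le> int n"
    then show "g (k + l) = x (k + l)"
      using that y'[of "k + l"] by (auto simp: g_def algebra_simps)
  qed
  show ge: "word n k g = word n (k - i + j) y" if "k \<ge> i" for k
    using that by (auto simp: word_eq_iff g_def algebra_simps)
  have "word n k g \<in> S" for k
    using le[of k] ge[of k] x y X_eq by (cases "k \<le> i") auto
  moreover have "range g \<subseteq> A"
    using x y X_subset by (auto simp: g_def topspace_full_shift)
  ultimately show "g \<in> X" by (subst X_eq) (auto simp: topspace_full_shift)
qed

lemma reach_trans:
  assumes "reach u v" "reach v w"
  shows "reach u w"
proof -
  obtain x i j where x: "x \<in> X" "i \<le> j" "word n i x = u" "word n j x = v"
    using assms(1) by (auto simp: reach_def)
  obtain y k l where y: "y \<in> X" "k \<le> l" "word n k y = v" "word n l y = w"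
    using assms(2) by (auto simp: reach_def)
  have eq: "word n j x = word n k y" using x y by simp
  note g = glue[OF x(1) y(1) eq]
  show ?thesis
    using reach_word[OF g(1), of i "l - k + j"] g(2)[of i] g(3)[of "l - k + j"] x y by simp
qed

text \<open>Two gluings: from \<open>z\<close> onto a point \<open>q\<close> witnessing
  reachability, then from \<open>q\<close> onto \<open>y\<close>. The last conclusion keeps track of
  the words so that \<open>p\<close> can be shown to stay in the class of \<open>z\<close> and
  \<open>y\<close>.\<close>

lemma bridge:
  assumes z: "z \<in> X" and y: "y \<in> X" and r: "reach (word n i z) (word n j y)"
  obtains p s where "p \<in> X" "s \<ge> i - j" "\<And>k. k \<le> i \<Longrightarrow> p k = z k"
    "\<And>k. k > j \<Longrightarrow> p (k + s) = y k"
    "\<And>k. word n k p \<in> range (\<lambda>k. word n k z) \<or> word n k p \<in> range (\<lambda>k. word n k y) \<or>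
       reach (word n i z) (word n k p) \<and> reach (word n k p) (word n j y)"
proof -
  obtain q a b where q: "q \<in> X" "a \<le> b" "word n a q = word n i z" "word n b q = word n j y"
    using r by (auto simp: reach_def)
  define g where "g = (\<lambda>k. if k \<le> i then z k else q (k - i + a))"
  note g = glue[OF z q(1) q(3)[symmetric], folded g_def]
  \<comment> \<open>The place in \<open>g\<close> where the occurrence at \<open>b\<close> in
    \<open>q\<close> ends up.\<close>
  define c where "c = i + b - a"
  have c: "i \<le> c" using q(2) by (simp add: c_def)
  have eq: "word n c g = word n j y" using g(3)[OF c] q(4) by (simp add: c_def)
  define p where "p = (\<lambda>k. if k \<le> c then g k else y (k - c + j))"
  note p = glue[OF g(1) y eq, folded p_def]
  show thesis
  proof (rule that[OF p(1), of "c - j"])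
    show "i - j \<le> c - j" using c by simp
    show "p k = z k" if "k \<le> i" for k using that c by (simp add: p_def g_def)
    show "p (k + (c - j)) = y k" if "k > j" for k using that by (simp add: p_def)
    fix k
    consider "k \<le> i" | "i \<le> k" "k \<le> c" | "c \<le> k" by linarith
    then show "word n k p \<in> range (\<lambda>k. word n k z) \<or> word n k p \<in> range (\<lambda>k. word n k y) \<or>
       reach (word n i z) (word n k p) \<and> reach (word n k p) (word n j y)"
    proof cases
      case 1
      then have "word n k p = word n k z" using p(2)[of k] g(2)[of k] c by simp
      then show ?thesis by blast
    next
      case 2
      then have "word n k p = word n (k - i + a) q" using p(2)[of k] g(3)[of k] by simp
      then show ?thesis
        using reach_word[OF q(1), of a "k - i + a"] reach_word[OF q(1), of "k - i + a" b] 2 q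
        by (simp add: c_def)
    next
      case 3
      then have "word n k p = word n (k - c + j) y" using p(3)[of k] by simp
      then show ?thesis by blast
    qed
  qed
qed

section \<open>Strongly connected classes of words and the irreducible components\<close>

definition scc :: "'a list \<Rightarrow> (int \<Rightarrow> 'a) set" where
  "scc u = {x \<in> X. \<forall>i. reach (word n i x) u \<and> reach u (word n i x)}"

lemma scc_eqI:
  assumes "x \<in> scc u" "x \<in> scc v"
  shows "scc u = scc v"
proof -
  have "reach u v" "reach v u"
    using assms reach_trans[of u "word n 0 x" v] reach_trans[of v "word n 0 x" u]
    by (auto simp: scc_def)
  then have "reach w u \<and> reach u w \<longleftrightarrow> reach w v \<and> reach v w" for w
    using reach_trans by metis
  then show ?thesis by (simp add: scc_def)
qed

text \<open>Closedness: leaving the class is witnessed by a single word, hence by a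
  cylinder.\<close>

lemma subshift_scc: "subshift A (scc u)"
proof -
  have inv: "shift_by s x \<in> scc u" if "x \<in> scc u" for s x
    using that by (auto simp: scc_def shift_by_mem word_shift_by)
  have "shift_map ` scc u = scc u"
  proof (intro subset_antisym subsetI)
    fix x assume "x \<in> scc u"
    then have "shift_by (-1) x \<in> scc u" "x = shift_map (shift_by (-1) x)"
      by (auto simp: inv shift_map_eq)
    then show "x \<in> shift_map ` scc u" by blast
  qed (auto simp: inv shift_map_eq)
  moreover have "closedin (shift_top A X) (scc u)"
    unfolding closedin_def
  proof
    show "openin (shift_top A X) (topspace (shift_top A X) - scc u)"
    proof (subst openin_subopen, intro ballI)
      fix x assume "x \<in> topspace (shift_top A X) - scc u"
      then obtain i where x: "x \<in> X" "\<not> (reach (word n i x) u \<and> reach u (word n i x))"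
        by (auto simp: scc_def)
      let ?T = "{y \<in> X. \<forall>k\<in>{i+1..i+int n}. y k = x k}"
      have "openin (shift_top A X) ?T"
        using x X_subset by (intro openin_cylinder_subspace) auto
      moreover have "word n i y = word n i x" if "y \<in> ?T" for y
        using that by (auto simp: word_eq_iff)
      then have "y \<notin> scc u" if "y \<in> ?T" for y
        using x(2) that unfolding scc_def by (metis (mono_tags, lifting) mem_Collect_eq)
      then have "?T \<subseteq> topspace (shift_top A X) - scc u"
        unfolding topspace_X by blast
      ultimately show "\<exists>T. openin (shift_top A X) T \<and> x \<in> T \<and>
          T \<subseteq> topspace (shift_top A X) - scc u"
        using x(1) by blast
    qed
  qed (use X_subset in \<open>auto simp: scc_def\<close>)
  ultimately show ?thesis
    using closedin_trans_full subshift by (auto simp: subshift_def)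
qed

lemma irreducible_scc:
  assumes "scc u \<noteq> {}"
  shows "irreducible_subshift A (scc u)"
  unfolding irreducible_subshift_def
proof (intro conjI allI impI assms subshift_scc)
  fix U W
  assume UW: "openin (shift_top A (scc u)) U \<and> U \<noteq> {} \<and> openin (shift_top A (scc u)) W \<and> W \<noteq> {}"
  then obtain y z where yz: "y \<in> U" "z \<in> W" by auto
  have mem: "y \<in> scc u" "z \<in> scc u" using UW yz openin_subset by fastforce+
  obtain m1 where m1: "m1 \<ge> 0" "\<And>x. x \<in> scc u \<Longrightarrow> x \<in> topspace (full_shift A) \<Longrightarrow>
     (\<And>k. - m1 \<le> k \<Longrightarrow> k \<le> m1 \<Longrightarrow> x k = y k) \<Longrightarrow> x \<in> U"
    using openin_contains_cylinder UW yz(1) by metis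
  obtain m2 where m2: "m2 \<ge> 0" "\<And>x. x \<in> scc u \<Longrightarrow> x \<in> topspace (full_shift A) \<Longrightarrow>
     (\<And>k. - m2 \<le> k \<Longrightarrow> k \<le> m2 \<Longrightarrow> x k = z k) \<Longrightarrow> x \<in> W"
    using openin_contains_cylinder UW yz(2) by metis
  have zX: "z \<in> X" and yX: "y \<in> X" using mem by (auto simp: scc_def)
  \<comment> \<open>With these positions the bridge keeps \<open>z\<close> up to \<open>m2\<close>
    and, after the shift by \<open>s\<close>, \<open>y\<close> from \<open>- m1\<close> on; thus
    both windows survive and \<open>s \<ge> m1 + m2 + 1\<close> is positive.\<close>
  have "reach (word n m2 z) (word n (- m1 - 1) y)"
    using mem unfolding scc_def by (blast intro: reach_trans)
  then obtain p s where p: "p \<in> X" "s \<ge> m2 - (- m1 - 1)" "\<And>k. k \<le> m2 \<Longrightarrow> p k = z k"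
    "\<And>k. k > - m1 - 1 \<Longrightarrow> p (k + s) = y k"
    "\<And>k. word n k p \<in> range (\<lambda>k. word n k z) \<or> word n k p \<in> range (\<lambda>k. word n k y) \<or>
       reach (word n m2 z) (word n k p) \<and> reach (word n k p) (word n (- m1 - 1) y)"
    using bridge[OF zX yX] by metis
  have words: "reach (word n k y) u \<and> reach u (word n k y)"
    "reach (word n k z) u \<and> reach u (word n k z)" for k
    using mem by (auto simp: scc_def)
  then have "reach (word n k p) u \<and> reach u (word n k p)" for k
    using p(5)[of k] reach_trans by (elim disjE) (auto, metis+)
  then have pC: "p \<in> scc u" using p(1) by (simp add: scc_def)
  have sC: "shift_by s p \<in> scc u" by (rule shift_by_mem_subshift[OF subshift_scc pC])
  have "p \<in> W" using p pC X_subset by (intro m2) auto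
  moreover have "shift_by s p \<in> U"
    using p sC X_subset shift_by_mem by (intro m1) (auto simp: shift_by_def)
  moreover have "shift_by s p = (shift_map ^^ nat s) p"
    using p(2) m1 m2 by (simp add: funpow_shift_map)
  moreover have "nat s \<ge> 1" using p(2) m1(1) m2(1) by linarith
  ultimately show "\<exists>n\<ge>1. U \<inter> (shift_map ^^ n) ` W \<noteq> {}" by blast
qed

text \<open>Irreducibility applied to twice the same open set is recurrence.\<close>

lemma irreducible_subset_NW:
  assumes "irreducible_subshift A Y" "Y \<subseteq> X"
  shows "Y \<subseteq> NW A X"
proof
  fix x assume x: "x \<in> Y"
  show "x \<in> NW A X"
    unfolding NW_def
  proof (intro CollectI conjI allI impI)
    fix U assume "neighborhood_in (shift_top A X) x U"
    then obtain V where V: "openin (shift_top A X) V" "x \<in> V" "V \<subseteq> U"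
      by (auto simp: neighborhood_in_def)
    have "openin (shift_top A Y) (V \<inter> Y)"
      using V(1) assms(2) by (auto simp: openin_subtopology)
    moreover have "V \<inter> Y \<noteq> {}" using x V by auto
    ultimately obtain n :: nat where "n \<ge> 1" "(V \<inter> Y) \<inter> (shift_map ^^ n) ` (V \<inter> Y) \<noteq> {}"
      using assms(1) unfolding irreducible_subshift_def by meson
    then show "\<exists>n\<ge>1. U \<inter> (shift_map ^^ n) ` U \<noteq> {}" using V(3) by blast
  qed (use x assms in auto)
qed

text \<open>Recurrence lets the word at \<open>i + 1\<close> reach the word one place to its left;
  chaining these steps makes all words of \<open>x\<close> mutually reachable.\<close>

lemma NW_mem_scc:
  assumes "x \<in> NW A X"
  shows "x \<in> scc (word n i x)"
proof -
  have x: "x \<in> X" using assms by (simp add: NW_def)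
  text \<open>The window is one letter longer than a word, so that a return time of at least \<open>1\<close>
    already brings the second occurrence of the word at \<open>i\<close> past the first one of the word at
    \<open>i + 1\<close>; overlapping occurrences do no harm.\<close>
  have step: "reach (word n (i + 1) x) (word n i x)" for i
  proof -
    let ?U = "{y \<in> X. \<forall>k\<in>{i+1..i+1+int n}. y k = x k}"
    have "openin (shift_top A X) ?U"
      using x X_subset by (intro openin_cylinder_subspace) auto
    then have "neighborhood_in (shift_top A X) x ?U"
      using x openin_subset unfolding neighborhood_in_def by blast
    then obtain p :: nat where p: "p \<ge> 1" "?U \<inter> (shift_map ^^ p) ` ?U \<noteq> {}"
      using assms unfolding NW_def by blast
    then obtain y where y: "y \<in> ?U" "shift_by (int p) y \<in> ?U"
      by (auto simp: funpow_shift_map)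
    have "word n (i + 1) y = word n (i + 1) x" using y(1) by (auto simp: word_eq_iff)
    moreover have "word n i (shift_by (int p) y) = word n i x"
      using y(2) by (auto simp: word_eq_iff)
    moreover have "reach (word n (i + 1) y) (word n (i + int p) y)"
      using y p(1) by (intro reach_word) auto
    ultimately show ?thesis by (simp add: word_shift_by)
  qed
  have back_reach: "reach (word n (i + int m) x) (word n i x)" for i m
  proof (induction m)
    case 0
    then show ?case using x reach_word by simp
  next
    case (Suc m)
    then show ?case using step[of "i + int m"] by (auto intro: reach_trans simp: algebra_simps)
  qed
  have "reach (word n i x) (word n j x)" for i j
    using back_reach[of j "nat (i - j)"] reach_word[OF x, of i j] by (cases "i \<le> j") auto
  then show ?thesis using x by (simp add: scc_def)
qed

text \<open>The description in \<open>irr_components\<close> is resolved by exhibiting the classes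
  of words: there are finitely many words of length \<open>n\<close>, and non-empty classes are
  irreducible, disjoint and cover the non-wandering points.\<close>

lemma irr_components_eq: "irr_components A X = (\<lambda>x. scc (word n 0 x)) ` NW A X"
  and finite_irr_components: "finite (irr_components A X)"
  and partition_irr_components: "partition_on (NW A X) (irr_components A X)"
proof -
  let ?C = "(\<lambda>x. scc (word n 0 x)) ` NW A X"
  have "word n 0 ` X \<subseteq> {w. set w \<subseteq> A \<and> length w = n}"
    using X_subset by (fastforce simp: word_def topspace_full_shift)
  then have "finite (word n 0 ` NW A X)"
    using finite_lists_length_eq[OF finite_alphabet, of n]
    by (rule_tac finite_subset) (auto simp: NW_def)
  then have fin: "finite ?C"
    using finite_imageI[of "word n 0 ` NW A X" scc] by (simp add: image_image)
  have ne: "scc (word n 0 x) \<noteq> {}" if "x \<in> NW A X" for x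
    using NW_mem_scc[OF that] by blast
  then have irr: "\<forall>C\<in>?C. irreducible_subshift A C"
    using irreducible_scc by blast
  have part: "partition_on (NW A X) ?C"
  proof (rule partition_onI)
    have "scc (word n 0 x) \<subseteq> NW A X" if "x \<in> NW A X" for x
      using irreducible_subset_NW irreducible_scc[OF ne[OF that]] by (simp add: scc_def)
    then show "\<Union>?C = NW A X" using NW_mem_scc by blast
    show "disjnt p q" if "p \<in> ?C" "q \<in> ?C" "p \<noteq> q" for p q
      using that scc_eqI unfolding disjnt_def by blast
  qed (use ne in auto)
  have "irr_components A X = ?C"
    unfolding irr_components_def
  proof (rule the_equality)
    fix \<D> assume "finite \<D> \<and> partition_on (NW A X) \<D> \<and> (\<forall>C\<in>\<D>. irreducible_subshift A C)"
    then show "\<D> = ?C"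
      using fin part irr by (intro subset_antisym irreducible_partition_unique[of _ "NW A X" A]) auto
  qed (use fin irr part in auto)
  with fin part show "irr_components A X = ?C" "finite (irr_components A X)"
    "partition_on (NW A X) (irr_components A X)" by simp_all
qed

lemma component_scc:
  assumes "C \<in> irr_components A X"
  obtains u where "C = scc u"
  using assms by (auto simp: irr_components_eq)

lemma component_ne: "C \<in> irr_components A X \<Longrightarrow> C \<noteq> {}"
  using partition_irr_components partition_onD3 by metis

lemma component_eqI:
  "C \<in> irr_components A X \<Longrightarrow> D \<in> irr_components A X \<Longrightarrow> x \<in> C \<Longrightarrow> x \<in> D \<Longrightarrow> C = D"
  using partition_onD2[OF partition_irr_components] by (auto simp: disjoint_def)

lemma Union_components: "\<Union>(irr_components A X) = NW A X"
  using partition_onD1[OF partition_irr_components] by simp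

lemma component_subset: "C \<in> irr_components A X \<Longrightarrow> C \<subseteq> X"
  by (auto simp: irr_components_eq scc_def)

lemma subshift_component: "C \<in> irr_components A X \<Longrightarrow> subshift A C"
  using subshift_scc component_scc by metis

lemma irreducible_component: "C \<in> irr_components A X \<Longrightarrow> irreducible_subshift A C"
  by (metis component_scc component_ne irreducible_scc)

section \<open>Limit sets\<close>

text \<open>Only \<open>e = -1\<close> and \<open>e = 1\<close> matter; they give the \<open>\<alpha>\<close>- and \<open>\<omega>\<close>-limit sets.\<close>

definition limit_set :: "int \<Rightarrow> (int \<Rightarrow> 'a) \<Rightarrow> (int \<Rightarrow> 'a) set" where
  "limit_set e x = {y. \<exists>m::nat \<Rightarrow> nat. strict_mono m \<and>
     limitin (shift_top A X) (\<lambda>k. shift_by (e * int (m k)) x) y sequentially}"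

lemma alpha_limit_set_eq: "alpha_limit_set A X x = limit_set (-1) x"
  by (simp add: alpha_limit_set_def limit_set_def funpow_inv_shift_map)

lemma omega_limit_set_eq: "omega_limit_set A X x = limit_set 1 x"
  by (simp add: omega_limit_set_def limit_set_def funpow_shift_map)

lemma limit_set_ne:
  assumes "x \<in> X"
  shows "limit_set e x \<noteq> {}"
proof -
  have "range (\<lambda>k. shift_by (e * int k) x) \<subseteq> X" using assms shift_by_mem by auto
  then obtain l r where "strict_mono (r :: nat \<Rightarrow> nat)"
    "limitin (shift_top A X) ((\<lambda>k. shift_by (e * int k) x) \<circ> r) l sequentially"
    using sequentially_compact_full_shift[OF finite_alphabet] subshift
    unfolding subshift_def by metis
  then show ?thesis by (auto simp: limit_set_def o_def)
qed

lemma limit_set_subset: "limit_set e x \<subseteq> X"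
  using limitin_topspace by (fastforce simp: limit_set_def)

lemma limit_set_word_occurs:
  assumes "y \<in> limit_set e x"
  obtains m :: nat where "m \<ge> N" "word n (i + e * int m) x = word n i y"
proof -
  obtain m :: "nat \<Rightarrow> nat" where m: "strict_mono m"
    "limitin (shift_top A X) (\<lambda>k. shift_by (e * int (m k)) x) y sequentially"
    using assms by (auto simp: limit_set_def)
  let ?U = "{z \<in> X. \<forall>k\<in>{i+1..i+int n}. z k = y k}"
  have y: "y \<in> X" using assms limit_set_subset by auto
  then have "openin (shift_top A X) ?U" "y \<in> ?U"
    using X_subset by (auto intro!: openin_cylinder_subspace)
  then have "\<forall>\<^sub>F k in sequentially. shift_by (e * int (m k)) x \<in> ?U"
    using m(2) unfolding limitin_def by blast
  then obtain K where K: "\<And>k. k \<ge> K \<Longrightarrow> shift_by (e * int (m k)) x \<in> ?U"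
    unfolding eventually_sequentially by blast
  \<comment> \<open>A strictly increasing sequence satisfies \<open>m k \<ge> k\<close>, so this
    index also makes the shift at least \<open>N\<close>.\<close>
  let ?k = "max K N"
  have "word n i (shift_by (e * int (m ?k)) x) = word n i y"
    using K[of ?k] by (auto simp: word_eq_iff)
  moreover have "m ?k \<ge> N" using seq_suble[OF m(1), of ?k] by simp
  ultimately show thesis using that by (simp add: word_shift_by)
qed

lemma alpha_word_occurs:
  assumes "y \<in> limit_set (-1) x"
  obtains j where "j \<le> b" "word n j x = word n i y"
  by (rule limit_set_word_occurs[OF assms, of "nat (i - b)" i]) (rule that, auto)

lemma omega_word_occurs:
  assumes "y \<in> limit_set 1 x"
  obtains j where "j \<ge> b" "word n j x = word n i y"
  by (rule limit_set_word_occurs[OF assms, of "nat (b - i)" i]) (rule that, auto)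

text \<open>Words of limit points recur arbitrarily far out in \<open>x\<close>. For
  \<open>e = 1\<close> the source is located first and the target to its right; for
  \<open>e = -1\<close> the target first and the source to its left.\<close>

lemma limit_set_reach:
  assumes x: "x \<in> X" and e: "e = 1 \<or> e = -1" and y: "y \<in> limit_set e x" "z \<in> limit_set e x"
  shows "reach (word n i y) (word n j z)"
  using e
proof
  assume e: "e = 1"
  obtain a where a: "word n a x = word n i y" using omega_word_occurs y(1) e by metis
  obtain b where "b \<ge> a" "word n b x = word n j z" using omega_word_occurs y(2) e by metis
  with a reach_word[OF x, of a b] show ?thesis by simp
next
  assume e: "e = -1"
  obtain b where b: "word n b x = word n j z" using alpha_word_occurs y(2) e by metis
  obtain a where "a \<le> b" "word n a x = word n i y" using alpha_word_occurs y(1) e by metis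
  with b reach_word[OF x, of a b] show ?thesis by simp
qed

text \<open>The limit set lies in the class of any of its words; that class is non-empty, hence
  irreducible, hence non-wandering and a component.\<close>

lemma limit_set_in_component:
  assumes x: "x \<in> X" and e: "e = 1 \<or> e = -1"
  shows "\<exists>!C. C \<in> irr_components A X \<and> limit_set e x \<subseteq> C"
proof -
  obtain y where y: "y \<in> limit_set e x" using limit_set_ne[OF x] by blast
  have sub: "limit_set e x \<subseteq> scc (word n 0 y)"
    using limit_set_reach[OF x e] y limit_set_subset unfolding scc_def by blast
  then have "irreducible_subshift A (scc (word n 0 y))" using y irreducible_scc by blast
  then have "scc (word n 0 y) \<subseteq> NW A X"
    by (rule irreducible_subset_NW) (auto simp: scc_def)
  then have "y \<in> NW A X" using y sub by auto
  then have "scc (word n 0 y) \<in> irr_components A X" by (auto simp: irr_components_eq)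
  then show ?thesis using sub y component_eqI by (intro ex1I[of _ "scc (word n 0 y)"]) blast+
qed

definition limit_component :: "int \<Rightarrow> (int \<Rightarrow> 'a) \<Rightarrow> (int \<Rightarrow> 'a) set" where
  "limit_component e x = (THE C. C \<in> irr_components A X \<and> limit_set e x \<subseteq> C)"

lemma C_alpha_eq: "C_alpha A X x = limit_component (-1) x"
  by (simp add: C_alpha_def limit_component_def alpha_limit_set_eq)

lemma C_omega_eq: "C_omega A X x = limit_component 1 x"
  by (simp add: C_omega_def limit_component_def omega_limit_set_eq)

lemma limit_component:
  assumes "x \<in> X" "e = 1 \<or> e = -1"
  shows "limit_component e x \<in> irr_components A X" "limit_set e x \<subseteq> limit_component e x"
  using theI'[OF limit_set_in_component[OF assms]] unfolding limit_component_def by auto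

lemma limit_component_eqI:
  assumes "x \<in> X" "e = 1 \<or> e = -1" "C \<in> irr_components A X" "y \<in> limit_set e x" "y \<in> C"
  shows "limit_component e x = C"
  using limit_component[OF assms(1,2)] assms component_eqI by blast

text \<open>Every word of a limit point of \<open>x\<close> already occurs in \<open>x\<close>, so
  the limit point inherits the class.\<close>

lemma limit_component_of_mem:
  assumes C: "C \<in> irr_components A X" and x: "x \<in> C" and e: "e = 1 \<or> e = -1"
  shows "limit_component e x = C"
proof -
  have xX: "x \<in> X" using C x component_subset by auto
  obtain u where u: "C = scc u" using C component_scc by blast
  obtain y where y: "y \<in> limit_set e x" using limit_set_ne[OF xX] by blast
  have "reach (word n i y) u \<and> reach u (word n i y)" for i
    using limit_set_word_occurs[OF y, of 0 i] x u unfolding scc_def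
    by (metis (mono_tags, lifting) mem_Collect_eq)
  then have "y \<in> C" using u y limit_set_subset by (auto simp: scc_def)
  then show ?thesis using limit_component_eqI[OF xX e C y] by simp
qed

text \<open>Each word of \<open>x\<close> has a word of an \<alpha>-limit point to its left and one
  of an \<omega>-limit point to its right, both in the class of \<open>C\<close>.\<close>

lemma mem_component_if_limit_components:
  assumes x: "x \<in> X" and eq: "limit_component (-1) x = C" "limit_component 1 x = C"
  shows "x \<in> C"
proof -
  have C: "C \<in> irr_components A X" using limit_component(1)[OF x, of 1] eq by auto
  obtain u where u: "C = scc u" using C component_scc by blast
  obtain y where y: "y \<in> limit_set (-1) x" using limit_set_ne[OF x] by blast
  obtain z where z: "z \<in> limit_set 1 x" using limit_set_ne[OF x] by blast
  have yu: "y \<in> scc u" and zu: "z \<in> scc u"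
    using y z eq u limit_component(2)[OF x] by auto
  have "reach u (word n i x)" for i
  proof -
    obtain j where "j \<le> i" "word n j x = word n 0 y" using alpha_word_occurs[OF y] by metis
    then have "reach (word n 0 y) (word n i x)" using reach_word[OF x, of j i] by simp
    then show ?thesis using yu unfolding scc_def by (blast intro: reach_trans)
  qed
  moreover have "reach (word n i x) u" for i
  proof -
    obtain j where "j \<ge> i" "word n j x = word n 0 z" using omega_word_occurs[OF z] by metis
    then have "reach (word n i x) (word n 0 z)" using reach_word[OF x, of i j] by simp
    then show ?thesis using zu unfolding scc_def by (blast intro: reach_trans)
  qed
  ultimately show ?thesis using u x by (simp add: scc_def)
qed

end

section \<open>Endomorphisms\<close>

locale sft_endomorphism = sft +
  fixes \<tau> :: "(int \<Rightarrow> 'a) \<Rightarrow> (int \<Rightarrow> 'a)"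
  assumes endo: "shift_endomorphism A X \<tau>"
begin

lemma cont: "continuous_map (shift_top A X) (shift_top A X) \<tau>"
  using endo by (simp add: shift_endomorphism_def)

lemma image_mem: "x \<in> X \<Longrightarrow> \<tau> x \<in> X"
  using continuous_map_image_subset_topspace[OF cont, unfolded topspace_X] by auto

lemma equivariant:
  assumes "x \<in> X"
  shows "\<tau> (shift_by s x) = shift_by s (\<tau> x)"
proof -
  have pos: "\<tau> (shift_by (int k) y) = shift_by (int k) (\<tau> y)" if "y \<in> X" for k y
  proof (induction k)
    case (Suc k)
    have "\<tau> (shift_map (shift_by (int k) y)) = shift_map (\<tau> (shift_by (int k) y))"
      using endo that shift_by_mem by (simp add: shift_endomorphism_def)
    with Suc show ?case by (simp add: shift_map_eq)
  qed simp
  show ?thesis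
  proof (cases "s \<ge> 0")
    case True
    then show ?thesis using pos[OF assms, of "nat s"] by simp
  next
    case False
    then have "\<tau> x = shift_by (- s) (\<tau> (shift_by s x))"
      using pos[OF shift_by_mem[OF assms, of s], of "nat (- s)"] by simp
    then show ?thesis by simp
  qed
qed

lemma limit_set_image:
  assumes "x \<in> X" "y \<in> limit_set e x"
  shows "\<tau> y \<in> limit_set e (\<tau> x)"
proof -
  obtain m :: "nat \<Rightarrow> nat" where m: "strict_mono m"
    "limitin (shift_top A X) (\<lambda>k. shift_by (e * int (m k)) x) y sequentially"
    using assms by (auto simp: limit_set_def)
  have "limitin (shift_top A X) (\<tau> \<circ> (\<lambda>k. shift_by (e * int (m k)) x)) (\<tau> y) sequentially"
    by (rule continuous_map_limit[OF cont m(2)])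
  then show ?thesis using m(1) equivariant[OF assms(1)] by (auto simp: limit_set_def o_def)
qed

text \<open>A return to the preimage of a neighborhood is carried by \<tau> to a return to the
  neighborhood.\<close>

lemma NW_image: "\<tau> ` NW A X \<subseteq> NW A X"
proof (rule image_subsetI)
  fix x assume xNW: "x \<in> NW A X"
  then have x: "x \<in> X" by (simp add: NW_def)
  show "\<tau> x \<in> NW A X"
    unfolding NW_def
  proof (intro CollectI conjI allI impI image_mem x)
    fix U assume "neighborhood_in (shift_top A X) (\<tau> x) U"
    then obtain V where V: "openin (shift_top A X) V" "\<tau> x \<in> V" "V \<subseteq> U"
      by (auto simp: neighborhood_in_def)
    let ?W = "{z \<in> X. \<tau> z \<in> V}"
    have "openin (shift_top A X) ?W"
      using openin_continuous_map_preimage[OF cont V(1)] unfolding topspace_X .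
    then have "neighborhood_in (shift_top A X) x ?W"
      using x V(2) unfolding neighborhood_in_def topspace_X by blast
    then obtain m :: nat where m: "m \<ge> 1" "?W \<inter> (shift_map ^^ m) ` ?W \<noteq> {}"
      using xNW unfolding NW_def by blast
    then obtain z where "z \<in> X" "\<tau> z \<in> V" "\<tau> ((shift_map ^^ m) z) \<in> V" by blast
    then have "\<tau> z \<in> U" "(shift_map ^^ m) (\<tau> z) \<in> U"
      using V(3) by (auto simp: funpow_shift_map equivariant)
    then show "\<exists>m\<ge>1. U \<inter> (shift_map ^^ m) ` U \<noteq> {}" using m(1) by blast
  qed
qed

lemma component_image:
  assumes C: "C \<in> irr_components A X"
  shows "\<exists>D\<in>irr_components A X. \<tau> ` C \<subseteq> D"
proof (rule irreducible_image_in_one_part[OF irreducible_component[OF C]])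
  show "continuous_map (shift_top A C) (full_shift A) \<tau>"
    using continuous_map_from_subtopology_mono[OF _ component_subset[OF C]] cont
      continuous_map_into_fulltopology by blast
  show "\<tau> (shift_map y) = shift_map (\<tau> y)" if "y \<in> C" for y
    using that component_subset[OF C] equivariant by (auto simp: shift_map_eq)
  have "C \<subseteq> NW A X" using C Union_components by auto
  then show "\<tau> ` C \<subseteq> \<Union>(irr_components A X)"
    using NW_image Union_components by blast
qed (use finite_irr_components subshift_component partition_onD2[OF partition_irr_components]
    in auto)

lemma component_map:
  assumes "C \<in> irr_components A X"
  shows "component_map A X \<tau> C \<in> irr_components A X" "\<tau> ` C \<subseteq> component_map A X \<tau> C"
proof -
  let ?P = "\<lambda>\<rho>. \<rho> \<in> irr_components A X \<rightarrow>\<^sub>E irr_components A X \<and>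
     (\<forall>C \<in> irr_components A X. \<tau> ` C \<subseteq> \<rho> C)"
  obtain f where f: "\<And>C. C \<in> irr_components A X \<Longrightarrow> f C \<in> irr_components A X \<and> \<tau> ` C \<subseteq> f C"
    using component_image by metis
  have "\<exists>!\<rho>. ?P \<rho>"
  proof (rule ex_ex1I)
    \<comment> \<open>Restriction sets the value \<open>undefined\<close> off the components, as the
      extensional function space demands.\<close>
    show "\<exists>\<rho>. ?P \<rho>" using f by (intro exI[of _ "restrict f (irr_components A X)"]) auto
  next
    fix \<rho> \<rho>' assume \<rho>: "?P \<rho>" "?P \<rho>'"
    show "\<rho> = \<rho>'"
    proof (rule PiE_ext[OF conjunct1[OF \<rho>(1)] conjunct1[OF \<rho>(2)]])
      fix C assume C: "C \<in> irr_components A X"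
      then obtain x where "x \<in> C" using component_ne by blast
      then have "\<tau> x \<in> \<rho> C" "\<tau> x \<in> \<rho>' C" using \<rho> C by blast+
      then show "\<rho> C = \<rho>' C" using component_eqI \<rho> C by (metis PiE_mem)
    qed
  qed
  from theI'[OF this] show "component_map A X \<tau> C \<in> irr_components A X"
    "\<tau> ` C \<subseteq> component_map A X \<tau> C"
    using assms unfolding component_map_def by (meson PiE_mem)+
qed

text \<open>One limit point \<open>y\<close> decides: its image is a limit point of
  \<open>\<tau> x\<close> and lies in the image component.\<close>

lemma limit_component_image:
  assumes x: "x \<in> X" and e: "e = 1 \<or> e = -1"
  shows "limit_component e (\<tau> x) = component_map A X \<tau> (limit_component e x)"
proof -
  obtain y where y: "y \<in> limit_set e x" using limit_set_ne[OF x] by blast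
  note C = limit_component[OF x e]
  have "\<tau> y \<in> component_map A X \<tau> (limit_component e x)"
    using y C component_map(2)[OF C(1)] by blast
  then show ?thesis
    using limit_component_eqI[OF image_mem[OF x] e component_map(1)[OF C(1)]]
      limit_set_image[OF x y] by blast
qed

lemma monotone_component_map:
  "monotone_on (irr_components A X) (component_le A X) (component_le A X) (component_map A X \<tau>)"
proof (rule monotone_onI)
  fix C D assume "component_le A X C D"
  then obtain x where x: "x \<in> X" "limit_component (-1) x = C" "limit_component 1 x = D"
    by (auto simp: component_le_def C_alpha_eq C_omega_eq)
  then show "component_le A X (component_map A X \<tau> C) (component_map A X \<tau> D)"
    unfolding component_le_def C_alpha_eq C_omega_eq
    using image_mem limit_component_image by (intro bexI[of _ "\<tau> x"]) auto
qed

end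

section \<open>Surjective endomorphisms\<close>

locale sft_epimorphism = sft_endomorphism +
  assumes surj: "\<tau> ` X = X"
begin

abbreviation \<rho> :: "(int \<Rightarrow> 'a) set \<Rightarrow> (int \<Rightarrow> 'a) set" where
  "\<rho> \<equiv> component_map A X \<tau>"

abbreviation \<rho>_inv :: "(int \<Rightarrow> 'a) set \<Rightarrow> (int \<Rightarrow> 'a) set" where
  "\<rho>_inv \<equiv> inv_into (irr_components A X) \<rho>"

lemma preimage_point:
  assumes "y \<in> X"
  obtains x where "x \<in> X" "\<tau> x = y"
  using assms surj by (metis imageE)

lemma image_vimage: "Y \<subseteq> X \<Longrightarrow> \<tau> ` (\<tau> -` Y \<inter> X) = Y"
  using preimage_point by blast

text \<open>A lift \<open>x\<close> of a point of \<open>C\<close> is not yet known to be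
  non-wandering, but its \<omega>-limit component is mapped to \<open>C\<close>. A surjection of a
  finite set onto itself is bijective.\<close>

lemma bij_component_map: "bij_betw \<rho> (irr_components A X) (irr_components A X)"
proof -
  have "C \<in> \<rho> ` irr_components A X" if C: "C \<in> irr_components A X" for C
  proof -
    obtain y where y: "y \<in> C" using C component_ne by blast
    then obtain x where x: "x \<in> X" "\<tau> x = y"
      using preimage_point component_subset[OF C] by blast
    have "\<rho> (limit_component 1 x) = C"
      using limit_component_image[OF x(1), of 1] limit_component_of_mem[OF C y, of 1] x(2) by simp
    then show ?thesis using limit_component(1)[OF x(1), of 1] by blast
  qed
  then have "\<rho> ` irr_components A X = irr_components A X" using component_map(1) by blast
  then show ?thesis
    using finite_irr_components by (simp add: bij_betw_def finite_surj_inj)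
qed

lemma limit_component_preimage:
  assumes "x \<in> X" "e = 1 \<or> e = -1"
  shows "limit_component e x = \<rho>_inv (limit_component e (\<tau> x))"
  using limit_component_image[OF assms] limit_component(1)[OF assms] bij_component_map
  by (simp add: bij_betw_inv_into_left)

text \<open>For the inverse, a point witnessing the order relation is lifted through \<tau>; the
  lift witnesses the relation between the inverse images.\<close>

lemma poset_automorphism:
  "poset_automorphism_on (irr_components A X) (component_le A X) \<rho>"
  unfolding poset_automorphism_on_def
proof (intro conjI bij_component_map monotone_component_map monotone_onI)
  fix C D assume "component_le A X C D"
  then obtain y where y: "y \<in> X" "limit_component (-1) y = C" "limit_component 1 y = D"
    by (auto simp: component_le_def C_alpha_eq C_omega_eq)
  then obtain x where "x \<in> X" "\<tau> x = y" using preimage_point by blast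
  then show "component_le A X (\<rho>_inv C) (\<rho>_inv D)"
    unfolding component_le_def C_alpha_eq C_omega_eq
    using y limit_component_preimage by (intro bexI[of _ x]) auto
qed

text \<open>If \<open>\<tau> x\<close> lies in \<open>C\<close>, both its limit components are
  \<open>C\<close>, so both limit components of \<open>x\<close> are \<open>\<rho>_inv C\<close>,
  which captures \<open>x\<close> itself.\<close>

lemma preimage_component:
  assumes C: "C \<in> irr_components A X"
  shows "\<tau> -` C \<inter> X = \<rho>_inv C"
proof (intro subset_antisym subsetI)
  fix x assume "x \<in> \<tau> -` C \<inter> X"
  then have x: "x \<in> X" "\<tau> x \<in> C" by auto
  show "x \<in> \<rho>_inv C"
    by (rule mem_component_if_limit_components)
      (use x limit_component_preimage limit_component_of_mem[OF C] in auto)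
next
  fix x assume x: "x \<in> \<rho>_inv C"
  have D: "\<rho>_inv C \<in> irr_components A X" "\<rho> (\<rho>_inv C) = C"
    using C bij_component_map by (auto simp: bij_betw_inv_into_right bij_betw_def inv_into_into)
  then show "x \<in> \<tau> -` C \<inter> X"
    using x component_map(2)[OF D(1)] component_subset[OF D(1)] by auto
qed

text \<open>The preimage identity for \<open>\<rho> C\<close> says that \<open>C\<close> is the full
  preimage; surjectivity pushes this forward.\<close>

lemma image_component:
  assumes C: "C \<in> irr_components A X"
  shows "\<tau> ` C = \<rho> C"
proof -
  have "\<tau> -` \<rho> C \<inter> X = C"
    using preimage_component[OF component_map(1)[OF C]] C bij_component_map
    by (simp add: bij_betw_inv_into_left)
  then show ?thesis
    using image_vimage[OF component_subset[OF component_map(1)[OF C]]] by simp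
qed

lemma preimage_NW: "\<tau> -` NW A X \<inter> X = NW A X"
proof
  show "NW A X \<subseteq> \<tau> -` NW A X \<inter> X" using NW_image by (auto simp: NW_def)
  have "\<rho>_inv C \<in> irr_components A X" if "C \<in> irr_components A X" for C
    using that bij_component_map by (auto simp: bij_betw_def inv_into_into)
  then show "\<tau> -` NW A X \<inter> X \<subseteq> NW A X"
    using preimage_component unfolding Union_components[symmetric] by blast
qed

end

theorem proposition3p15:
  fixes A :: "'a set" and X :: "(int \<Rightarrow> 'a) set" and \<tau> :: "(int \<Rightarrow> 'a) \<Rightarrow> (int \<Rightarrow> 'a)"
  assumes "finite A"
    and "subshift_finite_type A X"
    and "shift_endomorphism A X \<tau>"
    and "\<tau> ` X = X"
  shows "poset_automorphism_on (irr_components A X) (component_le A X) (component_map A X \<tau>) \<and>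
    (\<forall>C \<in> irr_components A X.
       \<tau> -` C \<inter> X = inv_into (irr_components A X) (component_map A X \<tau>) C) \<and>
    (\<forall>C \<in> irr_components A X. \<tau> ` C = component_map A X \<tau> C) \<and>
    (\<tau> ` NW A X = NW A X \<and> \<tau> -` NW A X \<inter> X = NW A X) \<and>
    (\<tau> ` (X - NW A X) = X - NW A X \<and> \<tau> -` (X - NW A X) \<inter> X = X - NW A X)"
proof -
  obtain n S where "subshift A X" "X = {x \<in> topspace (full_shift A). \<forall>i. word n i x \<in> S}"
    using assms(2) unfolding subshift_finite_type_def word_def by blast
  then interpret sft_epimorphism A X n S \<tau>
    using assms by unfold_locales auto
  have pre: "\<tau> -` (X - NW A X) \<inter> X = X - NW A X"
    using preimage_NW image_mem by blast
  have "NW A X \<subseteq> X" by (auto simp: NW_def)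
  \<comment> \<open>Surjectivity turns each preimage identity into the image identity.\<close>
  then have "\<tau> ` NW A X = NW A X" "\<tau> ` (X - NW A X) = X - NW A X"
    using image_vimage[of "NW A X"] image_vimage[of "X - NW A X"] pre preimage_NW by simp_all
  then show ?thesis
    using poset_automorphism preimage_component image_component preimage_NW pre by simp
qed

end
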